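(* Let $\Sigma$ be a finite alphabet, let $u,v\in\Sigma^\star$ and $n\in\mathbb{N}$. If $u\equiv^2_{|\Sigma|+1,n}v$, then $u\equiv^2_n v$.
   Context: Words are finite structures with universe $\{1,\dots,|w|\}$, unary predicates $Q_a$ ($a\in\Sigma$) marking the positions carrying $a$, and the order $<$. $\mathrm{FO}^2_n[<]$ is first-order logic over this signature using only the two variables $x,y$, with quantifier depth at most $n$; $\mathrm{FO}^2_{m,n}[<]$ is the set of formulas of $\mathrm{FO}^2_n[<]$ in which every path in the parse tree has at most $m$ blocks of alternating quantifiers. $u\equiv^2_n v$ (resp. $u\equiv^2_{m,n}v$) means $u$ and $v$ satisfy the same sentences of $\mathrm{FO}^2_n[<]$ (resp. $\mathrm{FO}^2_{m,n}[<]$). *)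

theory Defs
  imports Main
begin

datatype var = X | Y

datatype 'a fo2 =
    TT
  | FF
  | Q 'a var
  | Less var var
  | Neg "'a fo2"
  | Conj "'a fo2" "'a fo2"
  | Disj "'a fo2" "'a fo2"
  | Ex var "'a fo2"
  | All var "'a fo2"

text \<open>Semantics: a word w has universe {1..|w|}; position i carries letter w!(i-1).\<close>
fun sat :: "'a list \<Rightarrow> (var \<Rightarrow> nat) \<Rightarrow> 'a fo2 \<Rightarrow> bool" where
  "sat w s TT = True"
| "sat w s FF = False"
| "sat w s (Q a z) = (w ! (s z - 1) = a)"
| "sat w s (Less z z') = (s z < s z')"
| "sat w s (Neg \<phi>) = (\<not> sat w s \<phi>)"
| "sat w s (Conj \<phi> \<psi>) = (sat w s \<phi> \<and> sat w s \<psi>)"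
| "sat w s (Disj \<phi> \<psi>) = (sat w s \<phi> \<or> sat w s \<psi>)"
| "sat w s (Ex z \<phi>) = (\<exists>i\<in>{1..length w}. sat w (s(z := i)) \<phi>)"
| "sat w s (All z \<phi>) = (\<forall>i\<in>{1..length w}. sat w (s(z := i)) \<phi>)"

fun free :: "'a fo2 \<Rightarrow> var set" where
  "free TT = {}"
| "free FF = {}"
| "free (Q a z) = {z}"
| "free (Less z z') = {z, z'}"
| "free (Neg \<phi>) = free \<phi>"
| "free (Conj \<phi> \<psi>) = free \<phi> \<union> free \<psi>"
| "free (Disj \<phi> \<psi>) = free \<phi> \<union> free \<psi>"
| "free (Ex z \<phi>) = free \<phi> - {z}"
| "free (All z \<phi>) = free \<phi> - {z}"

definition sentence :: "'a fo2 \<Rightarrow> bool" where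
  "sentence \<phi> \<longleftrightarrow> free \<phi> = {}"

text \<open>Satisfaction of a sentence (the assignment is irrelevant for sentences).\<close>
definition models :: "'a list \<Rightarrow> 'a fo2 \<Rightarrow> bool" where
  "models w \<phi> \<longleftrightarrow> sat w (\<lambda>_. 1) \<phi>"

fun qdepth :: "'a fo2 \<Rightarrow> nat" where
  "qdepth TT = 0"
| "qdepth FF = 0"
| "qdepth (Q a z) = 0"
| "qdepth (Less z z') = 0"
| "qdepth (Neg \<phi>) = qdepth \<phi>"
| "qdepth (Conj \<phi> \<psi>) = max (qdepth \<phi>) (qdepth \<psi>)"
| "qdepth (Disj \<phi> \<psi>) = max (qdepth \<phi>) (qdepth \<psi>)"
| "qdepth (Ex z \<phi>) = Suc (qdepth \<phi>)"
| "qdepth (All z \<phi>) = Suc (qdepth \<phi>)"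

text \<open>Maximal number of blocks of alternating quantifiers along a path of the parse tree.
  Negations are taken into account via the polarity p (True = positive): an existential
  quantifier under positive polarity (or a universal one under negative polarity) is
  effectively existential (kind True), otherwise effectively universal (kind False).
  c is the kind of the current (innermost enclosing) block, None if there is none.\<close>
fun blocks :: "bool \<Rightarrow> bool option \<Rightarrow> 'a fo2 \<Rightarrow> nat" where
  "blocks p c TT = 0"
| "blocks p c FF = 0"
| "blocks p c (Q a z) = 0"
| "blocks p c (Less z z') = 0"
| "blocks p c (Neg \<phi>) = blocks (\<not> p) c \<phi>"
| "blocks p c (Conj \<phi> \<psi>) = max (blocks p c \<phi>) (blocks p c \<psi>)"
| "blocks p c (Disj \<phi> \<psi>) = max (blocks p c \<phi>) (blocks p c \<psi>)"
| "blocks p c (Ex z \<phi>) =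
     (if c = Some p then blocks p c \<phi> else Suc (blocks p (Some p) \<phi>))"
| "blocks p c (All z \<phi>) =
     (if c = Some (\<not> p) then blocks p c \<phi> else Suc (blocks p (Some (\<not> p)) \<phi>))"

definition alt_blocks :: "'a fo2 \<Rightarrow> nat" where
  "alt_blocks \<phi> = blocks True None \<phi>"

definition fo2_equiv :: "nat \<Rightarrow> 'a list \<Rightarrow> 'a list \<Rightarrow> bool" where
  "fo2_equiv n u v \<longleftrightarrow>
     (\<forall>\<phi>. sentence \<phi> \<and> qdepth \<phi> \<le> n \<longrightarrow> (models u \<phi> \<longleftrightarrow> models v \<phi>))"

definition fo2_alt_equiv :: "nat \<Rightarrow> nat \<Rightarrow> 'a list \<Rightarrow> 'a list \<Rightarrow> bool" where
  "fo2_alt_equiv m n u v \<longleftrightarrow>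
     (\<forall>\<phi>. sentence \<phi> \<and> qdepth \<phi> \<le> n \<and> alt_blocks \<phi> \<le> m \<longrightarrow>
        (models u \<phi> \<longleftrightarrow> models v \<phi>))"

end

theory Submission
  imports Defs
begin

text \<open>A ranker (Weis and Immerman) is a sequence of instructions ``go to the next \<open>a\<close> on the
  right'' or ``on the left''. If the rankers of length at most \<open>n\<close> are defined on the same of the
  two words and their positions are ordered alike (length \<open>n\<close> against length \<open>n - 1\<close>), then
  Duplicator wins the \<open>n\<close>-round two-pebble game. A ranker with \<open>k\<close> turns is described by formulas
  with \<open>k + 1\<close> quantifier blocks, and a shortest ranker reaching a given position turns fewer times
  than the word has distinct letters: after each turn it is confined to an interval in which one more letter
  is missing, since leaving the interval would have made an earlier move superfluous. One more
  block is spent on comparing two rankers.\<close>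


section \<open>Directions\<close>

datatype direction = Leftward | Rightward

primrec opposite :: "direction \<Rightarrow> direction" where
  "opposite Leftward = Rightward"
| "opposite Rightward = Leftward"

primrec before_eq :: "direction \<Rightarrow> nat \<Rightarrow> nat \<Rightarrow> bool" where
  "before_eq Leftward p q \<longleftrightarrow> q \<le> p"
| "before_eq Rightward p q \<longleftrightarrow> p \<le> q"

primrec before :: "direction \<Rightarrow> nat \<Rightarrow> nat \<Rightarrow> bool" where
  "before Leftward p q \<longleftrightarrow> q < p"
| "before Rightward p q \<longleftrightarrow> p < q"

abbreviation before_eq_syntax ("(_/ \<preceq>\<^bsub>_\<^esub> _)" [51, 0, 51] 50) where
  "p \<preceq>\<^bsub>d\<^esub> q \<equiv> before_eq d p q"

abbreviation before_syntax ("(_/ \<prec>\<^bsub>_\<^esub> _)" [51, 0, 51] 50) where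
  "p \<prec>\<^bsub>d\<^esub> q \<equiv> before d p q"

interpretation travel: linorder "before_eq d" "before d" for d
  by unfold_locales (cases d; auto)+

lemma opposite_opposite [simp]: "opposite (opposite d) = d"
  by (cases d) auto

lemma opposite_neq [simp]: "opposite d \<noteq> d" "d \<noteq> opposite d"
  by (cases d; simp)+

lemma neq_iff_eq_opposite: "d \<noteq> e \<longleftrightarrow> d = opposite e"
  by (cases d; cases e) auto

lemma before_opposite [simp]: "p \<prec>\<^bsub>opposite d\<^esub> q \<longleftrightarrow> q \<prec>\<^bsub>d\<^esub> p"
  by (cases d) auto

lemma before_eq_opposite [simp]: "p \<preceq>\<^bsub>opposite d\<^esub> q \<longleftrightarrow> q \<preceq>\<^bsub>d\<^esub> p"
  by (cases d) auto

definition nearest :: "direction \<Rightarrow> nat set \<Rightarrow> nat option" where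
  "nearest d A = (if A = {} then None else Some (travel.Min d A))"

lemma nearest_eq_None_iff [simp]: "nearest d A = None \<longleftrightarrow> A = {}"
  by (simp add: nearest_def)

lemma nearest_eq_Some_iff:
  assumes "finite A"
  shows "nearest d A = Some p \<longleftrightarrow> p \<in> A \<and> (\<forall>q\<in>A. p \<preceq>\<^bsub>d\<^esub> q)"
  using assms by (auto simp: nearest_def travel.Min_eq_iff)

primrec word_end :: "'a list \<Rightarrow> direction \<Rightarrow> nat" where
  "word_end w Leftward = 0"
| "word_end w Rightward = Suc (length w)"

lemma word_end_le: "word_end w d \<le> Suc (length w)"
  by (cases d) auto

lemma before_word_end_iff [simp]:
  assumes "p \<in> {1..length w}"
  shows "p \<prec>\<^bsub>d\<^esub> word_end w e \<longleftrightarrow> d = e" "word_end w e \<prec>\<^bsub>d\<^esub> p \<longleftrightarrow> d = opposite e"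
  using assms by (cases d; cases e; auto)+

fun aligned :: "nat \<times> nat \<Rightarrow> nat \<times> nat \<Rightarrow> bool" where
  "aligned (p, p') (q, q') \<longleftrightarrow> (\<forall>d. p \<prec>\<^bsub>d\<^esub> q \<longleftrightarrow> p' \<prec>\<^bsub>d\<^esub> q')"

declare aligned.simps [simp del]

lemma alignedD: "aligned (p, p') (q, q') \<Longrightarrow> p \<prec>\<^bsub>d\<^esub> q \<longleftrightarrow> p' \<prec>\<^bsub>d\<^esub> q'"
  by (simp add: aligned.simps)

lemma alignedI:
  assumes "p \<prec>\<^bsub>d\<^esub> q \<longleftrightarrow> p' \<prec>\<^bsub>d\<^esub> q'" "p \<preceq>\<^bsub>d\<^esub> q \<longleftrightarrow> p' \<preceq>\<^bsub>d\<^esub> q'"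
  shows "aligned (p, p') (q, q')"
proof -
  have "p \<prec>\<^bsub>e\<^esub> q \<longleftrightarrow> p' \<prec>\<^bsub>e\<^esub> q'" for e
    using assms by (cases d; cases e) auto
  then show ?thesis by (simp add: aligned.simps)
qed

lemma aligned_if_before: "p \<prec>\<^bsub>d\<^esub> q \<Longrightarrow> p' \<prec>\<^bsub>d\<^esub> q' \<Longrightarrow> aligned (p, p') (q, q')"
  by (rule alignedI[where d = d]) (auto intro: travel.less_imp_le)

lemma aligned_refl: "aligned x x"
  by (cases x) (simp add: aligned.simps)

lemma aligned_sym: "aligned x y \<Longrightarrow> aligned y x"
  by (cases x; cases y) (metis aligned.simps before_opposite)

lemma aligned_prod_swap [simp]: "aligned (prod.swap x) (prod.swap y) \<longleftrightarrow> aligned x y"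
  by (cases x; cases y) (auto simp: aligned.simps)


section \<open>Rankers\<close>

text \<open>The latest instruction is outermost. \<open>End d\<close> is the position just outside the word at its
  end in direction \<open>d\<close>, so the first effective move of a ranker leads away from \<open>d\<close>.\<close>

datatype 'a ranker = End direction | Move "'a ranker" direction 'a

definition candidates :: "'a list \<Rightarrow> nat \<Rightarrow> direction \<Rightarrow> 'a \<Rightarrow> nat set" where
  "candidates w q d a = {p \<in> {1..length w}. w ! (p - 1) = a \<and> q \<prec>\<^bsub>d\<^esub> p}"

primrec ranker_pos :: "'a list \<Rightarrow> 'a ranker \<Rightarrow> nat option" where
  "ranker_pos w (End d) = Some (word_end w d)"
| "ranker_pos w (Move r d a) = Option.bind (ranker_pos w r) (\<lambda>q. nearest d (candidates w q d a))"

primrec moves :: "'a ranker \<Rightarrow> nat" where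
  "moves (End d) = 0"
| "moves (Move r d a) = Suc (moves r)"

primrec heading :: "'a ranker \<Rightarrow> direction" where
  "heading (End d) = opposite d"
| "heading (Move r d a) = d"

primrec turns :: "'a ranker \<Rightarrow> nat" where
  "turns (End d) = 0"
| "turns (Move r d a) = turns r + (if heading r = d then 0 else 1)"

lemma finite_candidates [simp]: "finite (candidates w q d a)"
  by (simp add: candidates_def)

lemma ranker_pos_Move_eq_Some_iff:
  "ranker_pos w (Move r d a) = Some p \<longleftrightarrow>
    (\<exists>q. ranker_pos w r = Some q \<and> p \<in> candidates w q d a \<and> (\<forall>x\<in>candidates w q d a. p \<preceq>\<^bsub>d\<^esub> x))"
  by (auto simp: bind_eq_Some_conv nearest_eq_Some_iff)

lemma ranker_pos_Move_eq_None_iff: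
  assumes "ranker_pos w r = Some q"
  shows "ranker_pos w (Move r d a) = None \<longleftrightarrow> candidates w q d a = {}"
  using assms by simp

declare ranker_pos.simps(2) [simp del]

lemma ranker_pos_MoveE:
  assumes "ranker_pos w (Move r d a) = Some p"
  obtains q where "ranker_pos w r = Some q" "q \<prec>\<^bsub>d\<^esub> p" "p \<in> {1..length w}" "w ! (p - 1) = a"
    "\<And>x. x \<in> candidates w q d a \<Longrightarrow> p \<preceq>\<^bsub>d\<^esub> x"
  using assms unfolding ranker_pos_Move_eq_Some_iff by (auto simp: candidates_def)

lemma ranker_pos_before_iff:
  assumes "ranker_pos w r = Some q" "ranker_pos w (Move r d a) = Some p"
  shows "p \<prec>\<^bsub>d\<^esub> x \<longleftrightarrow> (\<exists>y\<in>candidates w q d a. y \<prec>\<^bsub>d\<^esub> x)"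
    and "p \<preceq>\<^bsub>d\<^esub> x \<longleftrightarrow> (\<exists>y\<in>candidates w q d a. y \<preceq>\<^bsub>d\<^esub> x)"
proof -
  have p: "p \<in> candidates w q d a" "\<And>y. y \<in> candidates w q d a \<Longrightarrow> p \<preceq>\<^bsub>d\<^esub> y"
    using assms unfolding ranker_pos_Move_eq_Some_iff by auto
  show "p \<prec>\<^bsub>d\<^esub> x \<longleftrightarrow> (\<exists>y\<in>candidates w q d a. y \<prec>\<^bsub>d\<^esub> x)"
    using p travel.le_less_trans by blast
  show "p \<preceq>\<^bsub>d\<^esub> x \<longleftrightarrow> (\<exists>y\<in>candidates w q d a. y \<preceq>\<^bsub>d\<^esub> x)"
    using p travel.order_trans by blast
qed

lemma ranker_pos_le:
  assumes "ranker_pos w r = Some p"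
  shows "p \<le> Suc (length w)"
proof (cases r)
  case (End d)
  then show ?thesis using assms word_end_le by auto
next
  case (Move s d a)
  then show ?thesis using assms by (auto elim: ranker_pos_MoveE)
qed

lemma ranker_pos_Move_shortcut:
  assumes "ranker_pos w r = Some q" "ranker_pos w r' = Some q'" "q \<preceq>\<^bsub>d\<^esub> q'"
    and "ranker_pos w (Move r d a) = Some p" "q' \<prec>\<^bsub>d\<^esub> p"
  shows "ranker_pos w (Move r' d a) = Some p"
proof -
  have "candidates w q' d a \<subseteq> candidates w q d a"
    using assms(3) by (auto simp: candidates_def intro: travel.le_less_trans)
  moreover have "p \<in> candidates w q' d a"
    using assms(4,5) by (auto simp: candidates_def elim: ranker_pos_MoveE)
  ultimately show ?thesis
    using assms(1,2,4) unfolding ranker_pos_Move_eq_Some_iff by auto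
qed


section \<open>Rankers in two-variable logic\<close>

primrec other :: "var \<Rightarrow> var" where
  "other X = Y"
| "other Y = X"

lemma other_neq [simp]: "other z \<noteq> z" "z \<noteq> other z"
  by (cases z; simp)+

lemma neq_iff_eq_other: "y \<noteq> z \<longleftrightarrow> y = other z"
  by (cases y; cases z) auto

primrec before_fm :: "direction \<Rightarrow> var \<Rightarrow> var \<Rightarrow> 'a fo2" where
  "before_fm Leftward z z' = Less z' z"
| "before_fm Rightward z z' = Less z z'"

lemma before_fm_simps [simp]:
  "sat w s (before_fm d z z') \<longleftrightarrow> s z \<prec>\<^bsub>d\<^esub> s z'"
  "qdepth (before_fm d z z') = 0"
  "blocks p c (before_fm d z z') = 0"
  "free (before_fm d z z') = {z, z'}"
  by (cases d; auto)+

text \<open>If the last move of \<open>r\<close> goes in direction \<open>e\<close>, then lying beyond \<open>r\<close> in direction \<open>e\<close> is an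
  existential property; otherwise it is the negation of lying at \<open>r\<close> or beyond it in the opposite
  direction. So only the turns of \<open>r\<close> cost quantifier alternations.\<close>

primrec beyond_fm :: "'a ranker \<Rightarrow> direction \<Rightarrow> var \<Rightarrow> 'a fo2" where
  "beyond_fm (End d) e z = (if d = e then FF else TT)"
| "beyond_fm (Move r d a) e z =
     (let beyond = Ex (other z) (Conj (Q a (other z))
        (Conj (before_fm d (other z) z) (beyond_fm r d (other z))))
      in if d = e then beyond else Neg (Disj (Conj (Q a z) (beyond_fm r d z)) beyond))"

lemma qdepth_beyond_fm: "qdepth (beyond_fm r e z) \<le> moves r"
  by (induction r arbitrary: e z) (auto simp: Let_def intro: le_SucI)

lemma free_beyond_fm: "free (beyond_fm r e z) \<subseteq> {z}"
proof (induction r arbitrary: e z)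
  case (Move r d a)
  show ?case using Move[of d z] Move[of d "other z"] by (auto simp: Let_def)
qed simp

lemma blocks_beyond_fm:
  "blocks p c (beyond_fm r e z) \<le> turns r + (if c = Some ((heading r = e) = p) then 0 else 1)"
proof (induction r arbitrary: p c e z)
  case (Move r d a)
  have blocks_le: "blocks p' c' (beyond_fm r d y) \<le>
      turns (Move r d a) + (if c' = Some p' then 0 else 1)" for p' c' y
    using Move[of p' c' d y] by (auto split: if_splits)
  show ?case
    using blocks_le[of p "Some p" "other z"] blocks_le[of "\<not> p" "Some (\<not> p)" "other z"]
      blocks_le[of "\<not> p" c z]
    by (auto simp: Let_def split: if_splits)
qed simp

lemma sat_beyond_fm:
  assumes "ranker_pos w r = Some p" "s z \<in> {1..length w}"
  shows "sat w s (beyond_fm r e z) \<longleftrightarrow> p \<prec>\<^bsub>e\<^esub> s z"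
  using assms
proof (induction r arbitrary: p s e z)
  case (End d)
  then show ?case by (auto simp: neq_iff_eq_opposite)
next
  case (Move r d a)
  obtain q where q: "ranker_pos w r = Some q" and p: "p \<in> candidates w q d a"
    and least: "\<And>x. x \<in> candidates w q d a \<Longrightarrow> p \<preceq>\<^bsub>d\<^esub> x"
    using Move.prems(1) unfolding ranker_pos_Move_eq_Some_iff by blast
  have at_other: "sat w (s(other z := i)) (beyond_fm r d (other z)) \<longleftrightarrow> q \<prec>\<^bsub>d\<^esub> i"
    if "i \<in> {1..length w}" for i
    using Move.IH[OF q, of "s(other z := i)" "other z" d] that by (simp add: fun_upd_def)
  have "sat w s (beyond_fm (Move r d a) d z) \<longleftrightarrow> (\<exists>i\<in>candidates w q d a. i \<prec>\<^bsub>d\<^esub> s z)"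
    using at_other by (auto simp: Let_def candidates_def)
  also have "\<dots> \<longleftrightarrow> p \<prec>\<^bsub>d\<^esub> s z"
    using ranker_pos_before_iff(1)[OF q Move.prems(1)] by simp
  finally have ahead: "sat w s (beyond_fm (Move r d a) d z) \<longleftrightarrow> p \<prec>\<^bsub>d\<^esub> s z" .
  show ?case
  proof (cases "d = e")
    case True
    then show ?thesis using ahead by simp
  next
    case False
    have "sat w s (beyond_fm (Move r d a) e z) \<longleftrightarrow>
        \<not> (s z \<in> candidates w q d a \<or> p \<prec>\<^bsub>d\<^esub> s z)"
      using False ahead Move.IH[OF q, of s z d] Move.prems(2)
      by (auto simp: Let_def candidates_def)
    also have "\<dots> \<longleftrightarrow> \<not> p \<preceq>\<^bsub>d\<^esub> s z"
      using p least travel.le_less by blast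
    also have "\<dots> \<longleftrightarrow> p \<prec>\<^bsub>e\<^esub> s z"
      using False by (auto simp: travel.not_le neq_iff_eq_opposite)
    finally show ?thesis .
  qed
qed

definition holds_at :: "'a list \<Rightarrow> nat \<Rightarrow> 'a fo2 \<Rightarrow> bool" where
  "holds_at w x \<phi> \<longleftrightarrow> sat w ((\<lambda>_. 1)(X := x)) \<phi>"

lemma holds_at_Neg: "holds_at w x (Neg \<phi>) \<longleftrightarrow> \<not> holds_at w x \<phi>"
  by (simp add: holds_at_def)

lemma holds_at_beyond_fm:
  assumes "ranker_pos w r = Some p" "x \<in> candidates w q d a"
  shows "holds_at w x (beyond_fm r e X) \<longleftrightarrow> p \<prec>\<^bsub>e\<^esub> x"
  using sat_beyond_fm[OF assms(1), of "(\<lambda>_. 1)(X := x)"] assms(2)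
  by (simp add: holds_at_def candidates_def)

lemma alt_equiv_candidates:
  assumes equiv: "fo2_alt_equiv m n u v"
    and r: "moves r < n" "turns (Move r d a) < m"
    and \<chi>: "free \<chi> \<subseteq> {X}" "qdepth \<chi> < n" "blocks True (Some True) \<chi> < m"
    and pos: "ranker_pos u r = Some p" "ranker_pos v r = Some p'"
  shows "(\<exists>x\<in>candidates u p d a. holds_at u x \<chi>) \<longleftrightarrow>
    (\<exists>x\<in>candidates v p' d a. holds_at v x \<chi>)"
proof -
  define \<phi> where "\<phi> = Ex X (Conj (Q a X) (Conj (beyond_fm r d X) \<chi>))"
  have models_\<phi>: "models w \<phi> \<longleftrightarrow> (\<exists>x\<in>candidates w q d a. holds_at w x \<chi>)"
    if "ranker_pos w r = Some q" for w q
    using sat_beyond_fm[OF that, of "(\<lambda>_. 1)(X := x)" X d for x]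
    by (auto simp: models_def holds_at_def \<phi>_def candidates_def)
  have "sentence \<phi>"
    using \<chi>(1) free_beyond_fm[of r d X] by (auto simp: sentence_def \<phi>_def)
  moreover have "qdepth \<phi> \<le> n"
    using r(1) \<chi>(2) qdepth_beyond_fm[of r d X] by (simp add: \<phi>_def)
  moreover have "alt_blocks \<phi> \<le> m"
    using r(2) \<chi>(3) blocks_beyond_fm[of True "Some True" r d X]
    by (auto simp: alt_blocks_def \<phi>_def split: if_splits)
  ultimately have "models u \<phi> \<longleftrightarrow> models v \<phi>"
    using equiv by (simp add: fo2_alt_equiv_def)
  then show ?thesis
    using pos by (simp add: models_\<phi>)
qed

lemma alt_equiv_defined:
  assumes "fo2_alt_equiv m n u v" "moves r < n" "turns (Move r d a) < m"
    and "ranker_pos u r = Some p" "ranker_pos v r = Some p'"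
  shows "ranker_pos u (Move r d a) = None \<longleftrightarrow> ranker_pos v (Move r d a) = None"
  using alt_equiv_candidates[OF assms(1-3) _ _ _ assms(4,5), of TT] assms(2-5)
  by (auto simp: ranker_pos_Move_eq_None_iff holds_at_def)

lemma word_ends_aligned:
  assumes "ranker_pos u r = Some q" "ranker_pos v r = Some q'"
  shows "aligned (word_end u d, word_end v d) (q, q')"
proof (cases r)
  case (End e)
  then have "word_end u d \<prec>\<^bsub>f\<^esub> q \<longleftrightarrow> word_end v d \<prec>\<^bsub>f\<^esub> q'" for f
    using assms by (cases d; cases e; cases f) auto
  then show ?thesis by (simp add: aligned.simps)
next
  case (Move s e a)
  then have "q \<in> {1..length u}" "q' \<in> {1..length v}"
    using assms by (auto elim: ranker_pos_MoveE)
  then show ?thesis by (simp add: aligned.simps)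
qed

lemma alt_equiv_candidates_order:
  assumes equiv: "fo2_alt_equiv m n u v"
    and r: "moves r < n" "turns (Move r d a) < m"
    and pos: "ranker_pos u r = Some p" "ranker_pos v r = Some p'"
    and r': "moves r' < n" "Suc (turns r') < m" "ranker_pos u r' = Some q" "ranker_pos v r' = Some q'"
  shows "(\<exists>x\<in>candidates u p d a. x \<prec>\<^bsub>d\<^esub> q) \<longleftrightarrow> (\<exists>x\<in>candidates v p' d a. x \<prec>\<^bsub>d\<^esub> q')"
    and "(\<exists>x\<in>candidates u p d a. x \<preceq>\<^bsub>d\<^esub> q) \<longleftrightarrow> (\<exists>x\<in>candidates v p' d a. x \<preceq>\<^bsub>d\<^esub> q')"
proof -
  have transfer: "(\<exists>x\<in>candidates u p d a. holds_at u x \<chi>) \<longleftrightarrow>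
      (\<exists>x\<in>candidates v p' d a. holds_at v x \<chi>)"
    if "\<chi> \<in> {beyond_fm r' (opposite d) X, Neg (beyond_fm r' d X)}" for \<chi>
  proof (rule alt_equiv_candidates[OF equiv r _ _ _ pos])
    have "blocks b c (beyond_fm r' e X) < m" for b c e
      using blocks_beyond_fm[of b c r' e X] r'(2) by (simp split: if_splits)
    then show "blocks True (Some True) \<chi> < m" using that by auto
    show "qdepth \<chi> < n" using that qdepth_beyond_fm[of r' _ X] r'(1) le_less_trans by fastforce
    show "free \<chi> \<subseteq> {X}" using that free_beyond_fm[of r'] by fastforce
  qed
  show "(\<exists>x\<in>candidates u p d a. x \<prec>\<^bsub>d\<^esub> q) \<longleftrightarrow> (\<exists>x\<in>candidates v p' d a. x \<prec>\<^bsub>d\<^esub> q')"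
    using transfer[of "beyond_fm r' (opposite d) X"] r'(3,4)
    by (simp add: holds_at_beyond_fm cong: bex_cong)
  show "(\<exists>x\<in>candidates u p d a. x \<preceq>\<^bsub>d\<^esub> q) \<longleftrightarrow> (\<exists>x\<in>candidates v p' d a. x \<preceq>\<^bsub>d\<^esub> q')"
    using transfer[of "Neg (beyond_fm r' d X)"] r'(3,4)
    by (simp add: holds_at_Neg holds_at_beyond_fm travel.not_less cong: bex_cong)
qed

lemma alt_equiv_aligned:
  assumes equiv: "fo2_alt_equiv m n u v"
    and r: "moves r \<le> n" "turns r < m" "ranker_pos u r = Some p" "ranker_pos v r = Some p'"
    and r': "moves r' < n" "Suc (turns r') < m" "ranker_pos u r' = Some q" "ranker_pos v r' = Some q'"
  shows "aligned (p, p') (q, q')"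
proof (cases r)
  case (End d)
  then show ?thesis using word_ends_aligned[OF r'(3,4), of d] r(3,4) by simp
next
  case (Move s d a)
  obtain y y' where y: "ranker_pos u s = Some y" "ranker_pos v s = Some y'"
    using r(3,4) unfolding Move by (auto elim!: ranker_pos_MoveE)
  have "moves s < n" "turns (Move s d a) < m" using r(1,2) Move by simp_all
  then show ?thesis
    using alt_equiv_candidates_order[OF equiv _ _ y r'] r(3,4)
      ranker_pos_before_iff[OF y(1)] ranker_pos_before_iff[OF y(2)]
    unfolding Move by (intro alignedI[where d = d]) simp_all
qed


section \<open>Shortest rankers turn rarely\<close>

text \<open>\<open>bound r d\<close> is \<open>r\<close> without its moves in direction \<open>d\<close> after the last turn and without the
  move that precedes this turn, so the latter has traversed the stretch between \<open>bound r d\<close> and the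
  turn; before the first turn the bound is the far end of the word. A ranker is tight if after each
  turn it stays inside this stretch.\<close>

primrec bound :: "'a ranker \<Rightarrow> direction \<Rightarrow> 'a ranker" where
  "bound (End e) d = End d"
| "bound (Move r e a) d = (if e = d then bound r d else r)"

primrec tight :: "'a list \<Rightarrow> 'a ranker \<Rightarrow> bool" where
  "tight w (End d) \<longleftrightarrow> True"
| "tight w (Move r d a) \<longleftrightarrow> tight w r \<and>
     (\<exists>p g. ranker_pos w (Move r d a) = Some p \<and> ranker_pos w (bound r d) = Some g \<and> p \<prec>\<^bsub>d\<^esub> g)"

lemma moves_bound: "moves (bound r d) \<le> moves r - 1"
  by (induction r) auto

lemma turns_bound: "turns (bound r d) \<le> turns r"
  by (induction r) auto

lemma bound_defined:
  assumes "ranker_pos w r = Some p"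
  shows "\<exists>g. ranker_pos w (bound r d) = Some g"
  using assms by (induction r arbitrary: p) (auto elim!: ranker_pos_MoveE)

lemma tight_defined:
  assumes "tight w r"
  obtains p where "ranker_pos w r = Some p"
  using assms by (cases r) auto

lemma tight_before_eq_bound:
  assumes "tight w r" "ranker_pos w r = Some p" "ranker_pos w (bound r d) = Some g"
  shows "p \<preceq>\<^bsub>d\<^esub> g"
proof (cases r)
  case (End e)
  then show ?thesis using assms(2,3) by (cases d; cases e) auto
next
  case (Move s e a)
  show ?thesis
  proof (cases "e = d")
    case True
    then show ?thesis using assms Move by (auto intro: travel.less_imp_le)
  next
    case False
    then have "g \<prec>\<^bsub>e\<^esub> p" using assms(2,3) Move by (auto elim!: ranker_pos_MoveE)
    with False show ?thesis by (auto simp: neq_iff_eq_opposite intro: travel.less_imp_le)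
  qed
qed

definition letters_between :: "'a list \<Rightarrow> direction \<Rightarrow> nat \<Rightarrow> nat \<Rightarrow> 'a set" where
  "letters_between w d p g = {w ! (x - 1) | x. x \<in> {1..length w} \<and> p \<prec>\<^bsub>d\<^esub> x \<and> x \<prec>\<^bsub>d\<^esub> g}"

lemma letters_between_subset: "letters_between w d p g \<subseteq> set w"
  by (auto simp: letters_between_def intro!: nth_mem)

lemma finite_letters_between [simp]: "finite (letters_between w d p g)"
  using letters_between_subset by (rule finite_subset) simp

lemma letters_between_mono: "p \<preceq>\<^bsub>d\<^esub> q \<Longrightarrow> letters_between w d q g \<subseteq> letters_between w d p g"
  by (auto simp: letters_between_def intro: travel.le_less_trans)

text \<open>The stretch entered by a turn lacks the letter the ranker has stopped at, since the ranker
  would have stopped earlier otherwise.\<close>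

lemma letters_between_turn:
  assumes r: "ranker_pos w r = Some q" "ranker_pos w (Move r e b) = Some p" and "p \<prec>\<^bsub>e\<^esub> g"
  shows "letters_between w (opposite e) p q \<subset> letters_between w e q g"
proof
  obtain p: "q \<prec>\<^bsub>e\<^esub> p" "p \<in> {1..length w}" "w ! (p - 1) = b"
    and first: "\<And>x. x \<in> candidates w q e b \<Longrightarrow> p \<preceq>\<^bsub>e\<^esub> x"
    using r by (auto elim: ranker_pos_MoveE)
  show "letters_between w (opposite e) p q \<subseteq> letters_between w e q g"
    using \<open>p \<prec>\<^bsub>e\<^esub> g\<close> by (auto simp: letters_between_def intro: travel.less_trans)
  have "b \<in> letters_between w e q g"
    using p \<open>p \<prec>\<^bsub>e\<^esub> g\<close> by (auto simp: letters_between_def)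
  moreover have "b \<notin> letters_between w (opposite e) p q"
    using first by (force simp: letters_between_def candidates_def travel.not_less[symmetric])
  ultimately show "letters_between w (opposite e) p q \<noteq> letters_between w e q g" by blast
qed

lemma turns_plus_letters_between:
  assumes "tight w r" "ranker_pos w r = Some p" "ranker_pos w (bound r d) = Some g" "p \<prec>\<^bsub>d\<^esub> g"
  shows "turns (Move r d a) + card (letters_between w d p g) \<le> card (set w)"
  using assms
proof (induction r arbitrary: d a p g)
  case (End e)
  then have "d \<noteq> e" by auto
  then have "opposite e = d" by (simp add: neq_iff_eq_opposite)
  then show ?case by (simp add: card_mono letters_between_subset)
next
  case (Move s e b)
  from Move.prems(2) obtain q where q: "ranker_pos w s = Some q" "q \<prec>\<^bsub>e\<^esub> p"
    by (rule ranker_pos_MoveE)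
  obtain h where h: "ranker_pos w (bound s e) = Some h" "p \<prec>\<^bsub>e\<^esub> h"
    using Move.prems(1,2) by auto
  have last_stretch: "turns (Move s e b) + card (letters_between w e q h) \<le> card (set w)"
    using Move.prems(1) Move.IH[OF _ q(1) h(1)] travel.less_trans[OF q(2) h(2)] by simp
  show ?case
  proof (cases "e = d")
    case True
    then have "letters_between w d p g \<subseteq> letters_between w e q h"
      using letters_between_mono[OF travel.less_imp_le[OF q(2)]] h(1) Move.prems(3) by simp
    then have "card (letters_between w d p g) \<le> card (letters_between w e q h)"
      by (simp add: card_mono)
    then show ?thesis using last_stretch True by simp
  next
    case False
    then have "d = opposite e" "g = q"
      using Move.prems(3) q(1) by (auto simp: neq_iff_eq_opposite)
    then have "card (letters_between w d p g) < card (letters_between w e q h)"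
      using letters_between_turn[OF q(1) Move.prems(2) h(2)] by (simp add: psubset_card_mono)
    then show ?thesis using last_stretch False by simp
  qed
qed

lemma tight_turns_le:
  assumes "tight w r"
  shows "turns r \<le> card (set w) - 1"
proof (cases r)
  case (Move s d a)
  then obtain p g where p: "ranker_pos w (Move s d a) = Some p"
    and g: "ranker_pos w (bound s d) = Some g" "p \<prec>\<^bsub>d\<^esub> g" and "tight w s"
    using assms by auto
  from p obtain q where q: "ranker_pos w s = Some q" "q \<prec>\<^bsub>d\<^esub> p" "p \<in> {1..length w}"
    by (rule ranker_pos_MoveE)
  then have "w ! (p - 1) \<in> letters_between w d q g"
    using g(2) by (auto simp: letters_between_def)
  then have "0 < card (letters_between w d q g)" by (auto simp: card_gt_0_iff)
  moreover have "q \<prec>\<^bsub>d\<^esub> g" using q(2) g(2) by (rule travel.less_trans)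
  ultimately show ?thesis
    using turns_plus_letters_between[OF \<open>tight w s\<close> q(1) g(1), of a] Move by simp
qed simp

definition shortest_on :: "'a list set \<Rightarrow> 'a ranker \<Rightarrow> bool" where
  "shortest_on W r \<longleftrightarrow>
     (\<forall>s. (\<forall>w\<in>W. ranker_pos w s = ranker_pos w r) \<longrightarrow> moves r \<le> moves s)"

lemma ex_shortest_on:
  obtains s where "shortest_on W s" "moves s \<le> moves r" "\<forall>w\<in>W. ranker_pos w s = ranker_pos w r"
proof -
  let ?same = "\<lambda>s. \<forall>w\<in>W. ranker_pos w s = ranker_pos w r"
  obtain s where "?same s" "\<And>s'. ?same s' \<Longrightarrow> moves s \<le> moves s'"
    using ex_has_least_nat[of ?same r moves] by blast
  then show ?thesis using that[of s] by (simp add: shortest_on_def)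
qed

lemma shortest_on_MoveD:
  assumes "shortest_on W (Move r d a)"
  shows "shortest_on W r"
  unfolding shortest_on_def
proof (intro allI impI)
  fix s
  assume "\<forall>w\<in>W. ranker_pos w s = ranker_pos w r"
  then have "\<forall>w\<in>W. ranker_pos w (Move s d a) = ranker_pos w (Move r d a)"
    by (simp add: ranker_pos.simps(2))
  then have "moves (Move r d a) \<le> moves (Move s d a)"
    using assms unfolding shortest_on_def by blast
  then show "moves r \<le> moves s" by simp
qed

lemma moves_bound_less:
  assumes "ranker_pos w (Move r d a) = Some p" "ranker_pos w (bound r d) = Some g" "g \<prec>\<^bsub>d\<^esub> p"
  shows "moves (bound r d) < moves r"
proof (cases r)
  case (End e)
  then have "g = word_end w d" using assms(2) by simp
  moreover have "p \<in> {1..length w}" using assms(1) by (rule ranker_pos_MoveE)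
  ultimately have "p \<prec>\<^bsub>d\<^esub> g" by simp
  with assms(3) show ?thesis using travel.less_asym by blast
next
  case (Move s e b)
  then show ?thesis using moves_bound[of r d] by simp
qed

lemma tight_shortcut_from_bound:
  assumes "tight w r" "ranker_pos w (Move r d a) = Some p"
    and "ranker_pos w (bound r d) = Some g" "g \<prec>\<^bsub>d\<^esub> p"
  shows "ranker_pos w (Move (bound r d) d a) = Some p"
proof -
  obtain q where q: "ranker_pos w r = Some q" using assms(1) by (rule tight_defined)
  have "q \<preceq>\<^bsub>d\<^esub> g" using assms(1) q assms(3) by (rule tight_before_eq_bound)
  then show ?thesis by (rule ranker_pos_Move_shortcut[OF q assms(3) _ assms(2,4)])
qed

text \<open>If the last move of a ranker reaches the bound, the bound itself is shorter; if it passes the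
  bound, it can be made from there directly.\<close>

lemma shortest_on_before_bound:
  assumes shortest: "shortest_on W (Move r d a)"
    and tight: "\<And>w. w \<in> W \<Longrightarrow> tight w r"
    and p: "\<And>w. w \<in> W \<Longrightarrow> ranker_pos w (Move r d a) = Some (p w)"
    and g: "\<And>w. w \<in> W \<Longrightarrow> ranker_pos w (bound r d) = Some (g w)"
    and aligned: "\<And>w w'. w \<in> W \<Longrightarrow> w' \<in> W \<Longrightarrow> aligned (p w, p w') (g w, g w')"
    and "w \<in> W"
  shows "p w \<prec>\<^bsub>d\<^esub> g w"
proof -
  have order: "p w' \<prec>\<^bsub>e\<^esub> g w' \<longleftrightarrow> p w \<prec>\<^bsub>e\<^esub> g w" if "w' \<in> W" for w' e
    using alignedD[OF aligned[OF that \<open>w \<in> W\<close>]] .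
  have shorter: "\<not> moves s \<le> moves r" if "\<And>w. w \<in> W \<Longrightarrow> ranker_pos w s = Some (p w)" for s
    using shortest that p by (fastforce simp: shortest_on_def)
  consider (inside) "p w \<prec>\<^bsub>d\<^esub> g w" | (reached) "p w = g w" | (passed) "g w \<prec>\<^bsub>d\<^esub> p w"
    using travel.less_linear by blast
  then show ?thesis
  proof cases
    case reached
    then have "p w' = g w'" if "w' \<in> W" for w'
      using order[OF that, of d] order[OF that, of "opposite d"] travel.neq_iff[of "p w'" "g w'" d]
      by simp
    then have "ranker_pos w' (bound r d) = Some (p w')" if "w' \<in> W" for w'
      using g that by simp
    from shorter[OF this] show ?thesis using moves_bound[of r d] by simp
  next
    case passed
    then have all_passed: "g w' \<prec>\<^bsub>d\<^esub> p w'" if "w' \<in> W" for w'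
      using order[OF that, of "opposite d"] by simp
    have "ranker_pos w' (Move (bound r d) d a) = Some (p w')" if "w' \<in> W" for w'
      using tight_shortcut_from_bound[OF tight p g all_passed] that by simp
    from shorter[OF this] show ?thesis
      using moves_bound_less[OF p g passed] \<open>w \<in> W\<close> by simp
  qed
qed

lemma alt_equiv_shortest_tight:
  assumes equiv: "fo2_alt_equiv (Suc (Suc k)) n u v"
    and letters: "card (set u) \<le> Suc k"
    and "shortest_on {u, v} r" "moves r \<le> n" "\<exists>w\<in>{u, v}. ranker_pos w r \<noteq> None"
  shows "\<forall>w\<in>{u, v}. tight w r"
  using assms(3-5)
proof (induction r)
  case (Move r d a)
  have "\<exists>w\<in>{u, v}. ranker_pos w r \<noteq> None"
    using Move.prems(3) by (auto elim!: ranker_pos_MoveE)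
  then have tight: "\<forall>w\<in>{u, v}. tight w r"
    using Move.IH shortest_on_MoveD[OF Move.prems(1)] Move.prems(2) by simp
  then obtain q q' where q: "ranker_pos u r = Some q" "ranker_pos v r = Some q'"
    by (metis insertCI tight_defined)
  have "turns r \<le> k" using tight tight_turns_le[of u r] letters by simp
  then have "turns (Move r d a) < Suc (Suc k)" by simp
  moreover have "moves r < n" using Move.prems(2) by simp
  ultimately have "\<forall>w\<in>{u, v}. \<exists>p. ranker_pos w (Move r d a) = Some p"
    using alt_equiv_defined[OF equiv _ _ q, of d a] Move.prems(3) by auto
  then obtain p where p: "\<And>w. w \<in> {u, v} \<Longrightarrow> ranker_pos w (Move r d a) = Some (p w)"
    by metis
  have "\<forall>w\<in>{u, v}. \<exists>g. ranker_pos w (bound r d) = Some g"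
    using bound_defined[OF q(1)] bound_defined[OF q(2)] by simp
  then obtain g where g: "\<And>w. w \<in> {u, v} \<Longrightarrow> ranker_pos w (bound r d) = Some (g w)"
    by metis
  have "aligned (p u, p v) (g u, g v)"
    using \<open>turns r \<le> k\<close> \<open>moves r < n\<close> p g turns_bound[of r d] moves_bound[of r d]
    by (intro alt_equiv_aligned[OF equiv, of "Move r d a" _ _ "bound r d"]) auto
  then have "aligned (p w, p w') (g w, g w')" if "w \<in> {u, v}" "w' \<in> {u, v}" for w w'
    using that by (auto simp: aligned.simps)
  then have "p w \<prec>\<^bsub>d\<^esub> g w" if "w \<in> {u, v}" for w
    using shortest_on_before_bound[OF Move.prems(1) _ p g _ that] tight by blast
  then show ?case using tight p g by simp
qed simp

lemma alt_equiv_few_turns: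
  assumes equiv: "fo2_alt_equiv (Suc (Suc k)) n u v"
    and letters: "card (set u) \<le> Suc k"
    and r: "moves r \<le> n" "\<exists>w\<in>{u, v}. ranker_pos w r \<noteq> None"
  shows "\<exists>s. moves s \<le> moves r \<and> turns s \<le> k \<and>
    (\<forall>w\<in>{u, v}. ranker_pos w s = ranker_pos w r \<and> ranker_pos w r \<noteq> None)"
proof -
  obtain s where s: "shortest_on {u, v} s" "moves s \<le> moves r"
    "\<forall>w\<in>{u, v}. ranker_pos w s = ranker_pos w r"
    by (rule ex_shortest_on)
  have tight: "\<forall>w\<in>{u, v}. tight w s"
    using s r by (intro alt_equiv_shortest_tight[OF equiv letters]) auto
  moreover have "turns s \<le> k" using tight tight_turns_le[of u s] letters by simp
  ultimately show ?thesis using s(2,3) by (metis option.discI tight_defined)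
qed


section \<open>The two-pebble game\<close>

definition landmarks :: "nat \<Rightarrow> 'a list \<Rightarrow> 'a list \<Rightarrow> (nat \<times> nat) set" where
  "landmarks n u v =
     {(p, p'). \<exists>r. moves r \<le> n \<and> ranker_pos u r = Some p \<and> ranker_pos v r = Some p'}"

definition rankers_agree :: "nat \<Rightarrow> 'a list \<Rightarrow> 'a list \<Rightarrow> bool" where
  "rankers_agree n u v \<longleftrightarrow>
     (\<forall>r. moves r \<le> n \<longrightarrow> (ranker_pos u r = None \<longleftrightarrow> ranker_pos v r = None)) \<and>
     (\<forall>m<n. \<forall>x\<in>landmarks n u v. \<forall>y\<in>landmarks m u v. aligned x y)"

lemma landmarks_Suc: "landmarks n u v \<subseteq> landmarks (Suc n) u v"
  unfolding landmarks_def using le_SucI by blast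

lemma landmarks_commute: "x \<in> landmarks n u v \<Longrightarrow> prod.swap x \<in> landmarks n v u"
  by (auto simp: landmarks_def)

lemma word_ends_landmark: "(word_end u d, word_end v d) \<in> landmarks n u v"
  unfolding landmarks_def by (auto intro!: exI[of _ "End d"])

lemma finite_Domain_landmarks: "finite (Domain (landmarks n u v))"
  by (rule finite_subset[of _ "{..Suc (length u)}"])
    (auto simp: landmarks_def dest: ranker_pos_le)

lemma rankers_agree_commute:
  assumes "rankers_agree n u v"
  shows "rankers_agree n v u"
  using assms unfolding rankers_agree_def
  by (metis aligned_prod_swap landmarks_commute)

lemma rankers_agree_SucD: "rankers_agree (Suc n) u v \<Longrightarrow> rankers_agree n u v"
  unfolding rankers_agree_def using landmarks_Suc[of n] by (meson le_SucI le_refl less_SucI subsetD)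

lemma rankers_agree_aligned:
  "rankers_agree (Suc n) u v \<Longrightarrow> x \<in> landmarks (Suc n) u v \<Longrightarrow> y \<in> landmarks n u v \<Longrightarrow> aligned x y"
  unfolding rankers_agree_def by blast

lemma rankers_agree_landmark:
  assumes "rankers_agree n u v" "moves r \<le> n" "ranker_pos u r = Some p"
  obtains p' where "ranker_pos v r = Some p'" "(p, p') \<in> landmarks n u v"
  using assms by (fastforce simp: rankers_agree_def landmarks_def)

lemma alt_equiv_rankers_agree:
  assumes equiv: "fo2_alt_equiv (Suc (Suc k)) n u v"
    and letters: "card (set u) \<le> Suc k"
  shows "rankers_agree n u v"
proof -
  note few_turns = alt_equiv_few_turns[OF equiv letters]
  have "aligned (p, p') (q, q')"
    if "m < n" "(p, p') \<in> landmarks n u v" "(q, q') \<in> landmarks m u v" for m p p' q q'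
  proof -
    obtain r where r: "moves r \<le> n" "ranker_pos u r = Some p" "ranker_pos v r = Some p'"
      using \<open>(p, p') \<in> _\<close> by (auto simp: landmarks_def)
    obtain r' where r': "moves r' < n" "ranker_pos u r' = Some q" "ranker_pos v r' = Some q'"
      using \<open>(q, q') \<in> _\<close> \<open>m < n\<close> by (auto simp: landmarks_def intro: le_less_trans)
    obtain s where "moves s \<le> moves r" "turns s \<le> k"
      "ranker_pos u s = Some p" "ranker_pos v s = Some p'"
      using few_turns[OF r(1)] r by auto
    moreover obtain s' where "moves s' \<le> moves r'" "turns s' \<le> k"
      "ranker_pos u s' = Some q" "ranker_pos v s' = Some q'"
      using few_turns[of r'] r' by auto
    ultimately show ?thesis using r(1) r'(1) by (intro alt_equiv_aligned[OF equiv, of s _ _ s']) auto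
  qed
  moreover have "ranker_pos u r = None \<longleftrightarrow> ranker_pos v r = None" if "moves r \<le> n" for r
    using few_turns[OF that] by blast
  ultimately show ?thesis unfolding rankers_agree_def by auto
qed

definition similar :: "nat \<Rightarrow> 'a list \<Rightarrow> 'a list \<Rightarrow> nat \<Rightarrow> nat \<Rightarrow> bool" where
  "similar n u v i i' \<longleftrightarrow> i \<in> {1..length u} \<and> i' \<in> {1..length v} \<and> u ! (i - 1) = v ! (i' - 1) \<and>
     (\<forall>x\<in>landmarks n u v. aligned x (i, i'))"

lemma similar_commute: "similar n u v i i' \<Longrightarrow> similar n v u i' i"
  unfolding similar_def by (metis aligned_prod_swap landmarks_commute swap_simp)

lemma similar_SucD: "similar (Suc n) u v i i' \<Longrightarrow> similar n u v i i'"
  unfolding similar_def using landmarks_Suc[of n] by auto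

lemma landmark_similar:
  assumes "rankers_agree (Suc n) u v" "(j, j') \<in> landmarks n u v" "j \<in> {1..length u}"
  shows "similar n u v j j'"
proof -
  obtain r where r: "ranker_pos u r = Some j" "ranker_pos v r = Some j'"
    using assms(2) by (auto simp: landmarks_def)
  obtain s d a where "r = Move s d a"
    using r(1) assms(3) before_word_end_iff by (cases r) fastforce+
  then have "j' \<in> {1..length v}" "u ! (j - 1) = v ! (j' - 1)"
    using r by (auto elim!: ranker_pos_MoveE)
  moreover have "aligned x (j, j')" if "x \<in> landmarks n u v" for x
    using rankers_agree_aligned[OF assms(1) _ assms(2)] that landmarks_Suc[of n u v] by blast
  ultimately show ?thesis using assms(3) by (simp add: similar_def)
qed

lemma ex_landmark_short_of_landmarks_ahead:
  assumes agree: "rankers_agree (Suc n) u v" and j: "j \<in> {1..length u}"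
  obtains t t' where "(t, t') \<in> landmarks (Suc n) u v" "j \<preceq>\<^bsub>d\<^esub> t"
    "\<forall>p\<in>Domain (landmarks n u v). j \<prec>\<^bsub>d\<^esub> p \<longrightarrow> t \<prec>\<^bsub>d\<^esub> p"
    "t' \<in> {1..length v}" "v ! (t' - 1) = u ! (j - 1)"
proof -
  define A where "A = {p \<in> Domain (landmarks n u v). j \<prec>\<^bsub>d\<^esub> p}"
  have "word_end u d \<in> A"
    unfolding A_def using word_ends_landmark[of u d v n] j by auto
  moreover have "finite A"
    unfolding A_def using finite_Domain_landmarks by (rule rev_finite_subset) auto
  ultimately obtain g where g: "g \<in> A" "\<And>p. p \<in> A \<Longrightarrow> g \<preceq>\<^bsub>d\<^esub> p"
    using travel.Min_in[of A d] travel.Min_le[of A _ d] by blast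
  then obtain r where r: "moves r \<le> n" "ranker_pos u r = Some g"
    by (auto simp: A_def landmarks_def)
  define a where "a = u ! (j - 1)"
  define target where "target = Move r (opposite d) a"
  have candidate: "j \<in> candidates u g (opposite d) a"
    using j g(1) by (simp add: candidates_def A_def a_def)
  then have "ranker_pos u target \<noteq> None"
    unfolding target_def using ranker_pos_Move_eq_None_iff[OF r(2)] by blast
  then obtain t where t: "ranker_pos u target = Some t" by blast
  then have "j \<preceq>\<^bsub>d\<^esub> t" "t \<prec>\<^bsub>d\<^esub> g"
    using candidate r(2) by (auto simp: target_def ranker_pos_Move_eq_Some_iff candidates_def)
  obtain t' where t': "ranker_pos v target = Some t'" "(t, t') \<in> landmarks (Suc n) u v"
    using rankers_agree_landmark[OF agree _ t] r(1) by (auto simp: target_def)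
  show ?thesis
  proof (rule that[OF t'(2) \<open>j \<preceq>\<^bsub>d\<^esub> t\<close>])
    show "\<forall>p\<in>Domain (landmarks n u v). j \<prec>\<^bsub>d\<^esub> p \<longrightarrow> t \<prec>\<^bsub>d\<^esub> p"
      using \<open>t \<prec>\<^bsub>d\<^esub> g\<close> g(2) travel.less_le_trans unfolding A_def by blast
    show "t' \<in> {1..length v}" "v ! (t' - 1) = u ! (j - 1)"
      using t'(1) by (auto simp: target_def a_def elim: ranker_pos_MoveE)
  qed
qed

lemma unseparated_aligned:
  assumes agree: "rankers_agree (Suc n) u v" and t: "(t, t') \<in> landmarks (Suc n) u v"
    and "j \<notin> Domain (landmarks n u v)" "j \<preceq>\<^bsub>d\<^esub> t"
    and landmarks_ahead: "\<forall>p\<in>Domain (landmarks n u v). j \<prec>\<^bsub>d\<^esub> p \<longrightarrow> t \<prec>\<^bsub>d\<^esub> p"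
    and p: "(p, p') \<in> landmarks n u v"
  shows "aligned (p, p') (j, t')"
proof -
  have order: "t \<prec>\<^bsub>e\<^esub> p \<longleftrightarrow> t' \<prec>\<^bsub>e\<^esub> p'" for e
    using rankers_agree_aligned[OF agree t p] by (rule alignedD)
  have "p \<noteq> j" using assms(3) p by blast
  then consider (behind) "p \<prec>\<^bsub>d\<^esub> j" | (ahead) "j \<prec>\<^bsub>d\<^esub> p"
    using travel.less_linear by blast
  then show ?thesis
  proof cases
    case behind
    then have "p \<prec>\<^bsub>d\<^esub> t" using assms(4) by (rule travel.less_le_trans)
    then have "p' \<prec>\<^bsub>d\<^esub> t'" using order[of "opposite d"] by simp
    with behind show ?thesis by (rule aligned_if_before)
  next
    case ahead
    then have "t' \<prec>\<^bsub>d\<^esub> p'" using landmarks_ahead p order by blast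
    with ahead show ?thesis by (intro aligned_sym[OF aligned_if_before])
  qed
qed

text \<open>If no landmark is at \<open>j\<close>, Duplicator steps back from the nearest landmark ahead to the first
  occurrence of the letter at \<open>j\<close>: no landmark separates the position reached from \<open>j\<close>.\<close>

lemma duplicator_answer_ahead:
  assumes agree: "rankers_agree (Suc n) u v"
    and i: "\<forall>x\<in>landmarks (Suc n) u v. aligned x (i, i')"
    and j: "j \<in> {1..length u}" "i \<prec>\<^bsub>d\<^esub> j"
  obtains j' where "similar n u v j j'" "i' \<prec>\<^bsub>d\<^esub> j'"
proof -
  have beyond_i: "i' \<prec>\<^bsub>d\<^esub> t'" if "(t, t') \<in> landmarks (Suc n) u v" "i \<prec>\<^bsub>d\<^esub> t" for t t'
    using i that alignedD before_opposite by metis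
  show ?thesis
  proof (cases "j \<in> Domain (landmarks n u v)")
    case True
    then obtain j' where j': "(j, j') \<in> landmarks n u v" by blast
    then have "i' \<prec>\<^bsub>d\<^esub> j'" using beyond_i j(2) landmarks_Suc[of n u v] by blast
    then show ?thesis using that landmark_similar[OF agree j' j(1)] by blast
  next
    case False
    obtain t t' where t: "(t, t') \<in> landmarks (Suc n) u v" "j \<preceq>\<^bsub>d\<^esub> t"
      and landmarks_ahead: "\<forall>p\<in>Domain (landmarks n u v). j \<prec>\<^bsub>d\<^esub> p \<longrightarrow> t \<prec>\<^bsub>d\<^esub> p"
      and t': "t' \<in> {1..length v}" "v ! (t' - 1) = u ! (j - 1)"
      using agree j(1) by (rule ex_landmark_short_of_landmarks_ahead[where d = d])
    have "aligned x (j, t')" if "x \<in> landmarks n u v" for x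
      using unseparated_aligned[OF agree t(1) False t(2) landmarks_ahead] that by (cases x) auto
    then have "similar n u v j t'" using j(1) t' by (simp add: similar_def)
    moreover have "i' \<prec>\<^bsub>d\<^esub> t'"
      using beyond_i[OF t(1)] j(2) t(2) by (blast intro: travel.less_le_trans)
    ultimately show ?thesis by (rule that)
  qed
qed

definition pebbles_similar ::
  "nat \<Rightarrow> 'a list \<Rightarrow> 'a list \<Rightarrow> var set \<Rightarrow> (var \<Rightarrow> nat) \<Rightarrow> (var \<Rightarrow> nat) \<Rightarrow> bool" where
  "pebbles_similar n u v V s t \<longleftrightarrow>
     (\<forall>z\<in>V. similar n u v (s z) (t z)) \<and> (\<forall>y\<in>V. \<forall>z\<in>V. aligned (s y, t y) (s z, t z))"

lemma pebbles_similar_commute: "pebbles_similar n u v V s t \<Longrightarrow> pebbles_similar n v u V t s"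
  unfolding pebbles_similar_def by (metis aligned_prod_swap similar_commute swap_simp)

lemma pebbles_similar_subset:
  "pebbles_similar n u v V s t \<Longrightarrow> W \<subseteq> V \<Longrightarrow> pebbles_similar n u v W s t"
  unfolding pebbles_similar_def by blast

lemma duplicator_answer:
  assumes agree: "rankers_agree (Suc n) u v"
    and pebbles: "pebbles_similar (Suc n) u v (V - {z}) s t" and j: "j \<in> {1..length u}"
  obtains j' where "similar n u v j j'" "\<forall>y\<in>V - {z}. aligned (s y, t y) (j, j')"
proof (cases "V - {z} = {}")
  case True
  have "aligned x (word_end u Leftward, word_end v Leftward)"
    if "x \<in> landmarks (Suc n) u v" for x
    using that by (auto simp: landmarks_def intro: aligned_sym word_ends_aligned simp del: word_end.simps)
  then obtain j' where "similar n u v j j'"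
    using duplicator_answer_ahead[OF agree _ j, of _ _ Rightward] j by fastforce
  then show ?thesis using that True by blast
next
  case False
  then obtain y where y: "V - {z} = {y}"
    using neq_iff_eq_other[of _ z] by fastforce
  then have similar_y: "similar (Suc n) u v (s y) (t y)"
    using pebbles by (simp add: pebbles_similar_def)
  show ?thesis
  proof (cases "s y = j")
    case True
    then have "similar n u v j (t y)" using similar_SucD[OF similar_y] by simp
    then show ?thesis using that[of "t y"] True y aligned_refl by simp
  next
    case False
    then obtain d where d: "s y \<prec>\<^bsub>d\<^esub> j" using travel.less_linear before_opposite by metis
    have "\<forall>x\<in>landmarks (Suc n) u v. aligned x (s y, t y)"
      using similar_y by (simp add: similar_def)
    then obtain j' where "similar n u v j j'" "t y \<prec>\<^bsub>d\<^esub> j'"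
      by (rule duplicator_answer_ahead[OF agree _ j d])
    moreover have "aligned (s y, t y) (j, j')"
      using d \<open>t y \<prec>\<^bsub>d\<^esub> j'\<close> by (rule aligned_if_before)
    ultimately show ?thesis using that[of j'] y by simp
  qed
qed

lemma pebbles_similar_update:
  assumes agree: "rankers_agree (Suc n) u v"
    and pebbles: "pebbles_similar (Suc n) u v (V - {z}) s t" and j: "j \<in> {1..length u}"
  shows "\<exists>j'\<in>{1..length v}. pebbles_similar n u v V (s(z := j)) (t(z := j'))"
proof -
  obtain j' where j': "similar n u v j j'" "\<forall>y\<in>V - {z}. aligned (s y, t y) (j, j')"
    using assms by (rule duplicator_answer)
  moreover have "aligned (j, j') (s y, t y)" if "y \<in> V - {z}" for y
    using j'(2) that by (blast intro: aligned_sym)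
  ultimately have "pebbles_similar n u v V (s(z := j)) (t(z := j'))"
    using pebbles unfolding pebbles_similar_def
    by (auto simp: aligned_refl intro: similar_SucD)
  then show ?thesis using j'(1) unfolding similar_def by blast
qed

lemma pebbles_similar_back_and_forth:
  assumes "rankers_agree (Suc n) u v" "pebbles_similar (Suc n) u v (V - {z}) s t"
  shows "rel_set (\<lambda>j j'. pebbles_similar n u v V (s(z := j)) (t(z := j')))
    {1..length u} {1..length v}"
proof (rule rel_setI)
  fix j
  assume "j \<in> {1..length u}"
  then show "\<exists>j'\<in>{1..length v}. pebbles_similar n u v V (s(z := j)) (t(z := j'))"
    using assms pebbles_similar_update by blast
next
  fix j'
  assume "j' \<in> {1..length v}"
  then show "\<exists>j\<in>{1..length u}. pebbles_similar n u v V (s(z := j)) (t(z := j'))"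
    using pebbles_similar_update[OF rankers_agree_commute pebbles_similar_commute] assms
      pebbles_similar_commute by blast
qed

lemma pebbles_similar_sat_quantifier:
  assumes "rankers_agree (Suc n) u v" "pebbles_similar (Suc n) u v (free \<phi> - {z}) s t"
    and same: "\<And>s t. pebbles_similar n u v (free \<phi>) s t \<Longrightarrow> sat u s \<phi> \<longleftrightarrow> sat v t \<phi>"
  shows "sat u s (Ex z \<phi>) \<longleftrightarrow> sat v t (Ex z \<phi>)" "sat u s (All z \<phi>) \<longleftrightarrow> sat v t (All z \<phi>)"
proof -
  note back_and_forth = pebbles_similar_back_and_forth[OF assms(1,2)]
  have "rel_fun (\<lambda>j j'. pebbles_similar n u v (free \<phi>) (s(z := j)) (t(z := j'))) (=)
      (\<lambda>j. sat u (s(z := j)) \<phi>) (\<lambda>j'. sat v (t(z := j')) \<phi>)"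
    using same by (simp add: rel_fun_def)
  then show "sat u s (Ex z \<phi>) \<longleftrightarrow> sat v t (Ex z \<phi>)" "sat u s (All z \<phi>) \<longleftrightarrow> sat v t (All z \<phi>)"
    using Bex_transfer[THEN rel_funD, THEN rel_funD, OF back_and_forth]
      Ball_transfer[THEN rel_funD, THEN rel_funD, OF back_and_forth] by simp_all
qed

lemma pebbles_similar_sat:
  assumes "rankers_agree n u v" "qdepth \<phi> \<le> n" "pebbles_similar n u v (free \<phi>) s t"
  shows "sat u s \<phi> \<longleftrightarrow> sat v t \<phi>"
  using assms
proof (induction \<phi> arbitrary: n s t)
  case (Q a z)
  then show ?case by (auto simp: pebbles_similar_def similar_def)
next
  case (Less z z')
  then have "s z \<prec>\<^bsub>Rightward\<^esub> s z' \<longleftrightarrow> t z \<prec>\<^bsub>Rightward\<^esub> t z'"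
    unfolding pebbles_similar_def by (intro alignedD) simp
  then show ?case by simp
next
  case (Conj \<phi> \<psi>)
  have "pebbles_similar n u v (free \<phi>) s t" "pebbles_similar n u v (free \<psi>) s t"
    using pebbles_similar_subset[OF Conj.prems(3)] by auto
  then show ?case using Conj by simp
next
  case (Disj \<phi> \<psi>)
  have "pebbles_similar n u v (free \<phi>) s t" "pebbles_similar n u v (free \<psi>) s t"
    using pebbles_similar_subset[OF Disj.prems(3)] by auto
  then show ?case using Disj by simp
next
  case (Ex z \<phi>)
  then obtain m where m: "n = Suc m" by (cases n) auto
  then have agree: "rankers_agree (Suc m) u v" and "qdepth \<phi> \<le> m"
    using Ex.prems(1,2) by simp_all
  then have "sat u s' \<phi> \<longleftrightarrow> sat v t' \<phi>" if "pebbles_similar m u v (free \<phi>) s' t'" for s' t'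
    using Ex.IH[OF rankers_agree_SucD _ that] by blast
  then show ?case
    using pebbles_similar_sat_quantifier(1)[OF agree] Ex.prems(3) m by simp
next
  case (All z \<phi>)
  then obtain m where m: "n = Suc m" by (cases n) auto
  then have agree: "rankers_agree (Suc m) u v" and "qdepth \<phi> \<le> m"
    using All.prems(1,2) by simp_all
  then have "sat u s' \<phi> \<longleftrightarrow> sat v t' \<phi>" if "pebbles_similar m u v (free \<phi>) s' t'" for s' t'
    using All.IH[OF rankers_agree_SucD _ that] by blast
  then show ?case
    using pebbles_similar_sat_quantifier(2)[OF agree] All.prems(3) m by simp
qed simp_all

lemma rankers_agree_imp_fo2_equiv:
  assumes "rankers_agree n u v"
  shows "fo2_equiv n u v"
  unfolding fo2_equiv_def models_def
proof (intro allI impI)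
  fix \<phi> :: "'a fo2"
  assume "sentence \<phi> \<and> qdepth \<phi> \<le> n"
  then show "sat u (\<lambda>_. 1) \<phi> \<longleftrightarrow> sat v (\<lambda>_. 1) \<phi>"
    by (intro pebbles_similar_sat[OF assms]) (auto simp: sentence_def pebbles_similar_def)
qed

theorem theorem4p7:
  fixes u v :: "'a::finite list" and n :: nat
  assumes "fo2_alt_equiv (card (UNIV :: 'a set) + 1) n u v"
  shows "fo2_equiv n u v"
proof -
  obtain k where k: "card (UNIV :: 'a set) = Suc k"
    using finite_UNIV_card_ge_0[where 'a = 'a] by (auto simp: gr0_conv_Suc)
  have "card (set u) \<le> Suc k"
    unfolding k[symmetric] by (intro card_mono) auto
  then have "rankers_agree n u v"
    using assms unfolding k by (intro alt_equiv_rankers_agree[of k]) auto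
  then show ?thesis by (rule rankers_agree_imp_fo2_equiv)
qed

end
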